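(* Let $x \in \mathbb{R}$ be disjunctive. Then $x$ wins every deterministic game that cannot be lost. Explicitly: let $b \ge 2$ be an integer, let $\mathcal{B} = \{0, 1, \dots, b-1\}$, let $V$ be a finite set, and let $\delta : V \times \mathcal{B} \to V$ be a function. Suppose that $\tilde v \in V$ is the unique sink state, i.e. the unique state $v\in V$ with $\delta(v, a) = v$ for all $a \in \mathcal{B}$, and that for every $v \in V$ there is a finite word $a_1 \dots a_k$ over $\mathcal{B}$ (with $k \ge 0$) that maps $v$ to $\tilde v$. Let $d_1 d_2 d_3 \dots$ be the sequence of digits of the base-$b$ expansion of $x$. Then for every initial state $v_0 \in V$, the sequence of states defined by $v_n = \delta(v_{n-1}, d_n)$ for $n \ge 1$ satisfies $v_n = \tilde v$ for some $n \geq 0$.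
   Context: A deterministic game with $b$ buttons is a finite directed labeled graph $G = (V, \mathcal{E})$. Here $V$ is the finite set of game states (including the state of any pseudo-random number generator), and for each state $v \in V$ and each button $a \in \mathcal{B} = \{0, \dots, b-1\}$ there is exactly one edge labeled $a$ leaving $v$, going to the state $\delta(v,a)$. A word $a_1 \dots a_k$ over $\mathcal{B}$ maps $v$ to $v'$ if starting at $v$ and successively applying $\delta(\cdot, a_1), \dots, \delta(\cdot, a_k)$, in this order, ends at $v'$. A state is a sink state if every edge leaving it returns to it. The state $\tilde v$ represents having won the game. "Cannot be lost" (win-reducible) means that from every state there is a path to $\tilde v$. To say that $x$ wins the game means that, when the digits of the base-$b$ expansion of $x$ are pressed in order as buttons, the game eventually reaches $\tilde v$. A real number $x$ is disjunctive in base $b$ if every finite word $w \in \{0, \dots, b-1\}^n$ (every $n \ge 1$) appears as a block of consecutive digits in the base-$b$ expansion of $x$. It is disjunctive if it is disjunctive in base $b$ for every integer $b \ge 2$. (A disjunctive number is irrational, so its base-$b$ expansion is unique.) Convention on digits: the base-$b$ expansion of $x$ is regarded as the infinite sequence consisting of the base-$b$ digits of the integer part of $|x|$ (most significant first, without leading zeros, or the single digit $0$ if the integer part is $0$) followed by the digits of the fractional part of $|x|$. The sign and the radix point are ignored. *)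

theory Defs
  imports Complex_Main
begin

(* Base-b digits of a natural number, most significant first, without leading zeros; the
   number 0 has the single digit 0.  The guard b < 2 only serves totality. *)
fun int_digits :: "nat \<Rightarrow> nat \<Rightarrow> nat list" where
  "int_digits b n = (if b < 2 \<or> n < b then [n] else int_digits b (n div b) @ [n mod b])"

declare int_digits.simps [simp del]

(* The j-th base-b digit after the radix point of \<bar>x\<bar>, counted from j = 0.  Where two expansions
   exist this picks the terminating one; disjunctive numbers are irrational. *)
definition frac_digit :: "nat \<Rightarrow> real \<Rightarrow> nat \<Rightarrow> nat" where
  "frac_digit b x j = nat \<lfloor>frac \<bar>x\<bar> * real b ^ Suc j\<rfloor> mod b"

(* The base-b expansion of x with sign and radix point ignored; digit b x n is d_(n+1) when
   digits are numbered from 1. *)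
definition digit :: "nat \<Rightarrow> real \<Rightarrow> nat \<Rightarrow> nat" where
  "digit b x n =
     (let ds = int_digits b (nat \<lfloor>\<bar>x\<bar>\<rfloor>)
      in if n < length ds then ds ! n else frac_digit b x (n - length ds))"

definition disjunctive_in_base :: "nat \<Rightarrow> real \<Rightarrow> bool" where
  "disjunctive_in_base b x \<longleftrightarrow>
     (\<forall>w. w \<noteq> [] \<and> set w \<subseteq> {..<b} \<longrightarrow> (\<exists>i. \<forall>j<length w. digit b x (i + j) = w ! j))"

definition disjunctive :: "real \<Rightarrow> bool" where
  "disjunctive x \<longleftrightarrow> (\<forall>b\<ge>2. disjunctive_in_base b x)"

(* The buttons are the naturals below b; values of the transition function outside the
   states V and the buttons are irrelevant. *)
definition deterministic_game :: "nat \<Rightarrow> 'v set \<Rightarrow> ('v \<Rightarrow> nat \<Rightarrow> 'v) \<Rightarrow> bool" where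
  "deterministic_game b V \<delta> \<longleftrightarrow> finite V \<and> (\<forall>v\<in>V. \<forall>a<b. \<delta> v a \<in> V)"

definition sink :: "nat \<Rightarrow> 'v set \<Rightarrow> ('v \<Rightarrow> nat \<Rightarrow> 'v) \<Rightarrow> 'v \<Rightarrow> bool" where
  "sink b V \<delta> v \<longleftrightarrow> v \<in> V \<and> (\<forall>a<b. \<delta> v a = v)"

definition maps_to :: "('v \<Rightarrow> nat \<Rightarrow> 'v) \<Rightarrow> nat list \<Rightarrow> 'v \<Rightarrow> 'v \<Rightarrow> bool" where
  "maps_to \<delta> w v v' \<longleftrightarrow> foldl \<delta> v w = v'"

definition cannot_be_lost :: "nat \<Rightarrow> 'v set \<Rightarrow> ('v \<Rightarrow> nat \<Rightarrow> 'v) \<Rightarrow> 'v \<Rightarrow> bool" where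
  "cannot_be_lost b V \<delta> t \<longleftrightarrow> (\<forall>v\<in>V. \<exists>w. set w \<subseteq> {..<b} \<and> maps_to \<delta> w v t)"

primrec play :: "('v \<Rightarrow> nat \<Rightarrow> 'v) \<Rightarrow> (nat \<Rightarrow> nat) \<Rightarrow> 'v \<Rightarrow> nat \<Rightarrow> 'v" where
  "play \<delta> d v0 0 = v0"
| "play \<delta> d v0 (Suc n) = \<delta> (play \<delta> d v0 n) (d n)"

definition wins :: "real \<Rightarrow> nat \<Rightarrow> ('v \<Rightarrow> nat \<Rightarrow> 'v) \<Rightarrow> 'v \<Rightarrow> 'v \<Rightarrow> bool" where
  "wins x b \<delta> t v0 \<longleftrightarrow> (\<exists>n. play \<delta> (digit b x) v0 n = t)"

end

theory Submission
  imports Defs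
begin

text \<open>
  A game that cannot be lost has a single word that wins it from every state at once. The
  states are treated one after another: if a word already sends some of them to the winning
  state, follow it from a further state and append a path from wherever that state has ended up;
  the states treated before stay won because the winning state is a sink. Finitely many steps
  exhaust the states (\<open>ex_universally_winning_word\<close>).

  A disjunctive number contains this word as a block of digits. It does not matter what the
  digits before the block are: they lead to some state of the game, and from there the block
  wins.
\<close>

lemma set_int_digits_subset:
  assumes "b \<ge> 2"
  shows "set (int_digits b n) \<subseteq> {..<b}"
  using assms
proof (induction b n rule: int_digits.induct)
  case (1 b n)
  then show ?case
    by (subst int_digits.simps) auto
qed

lemma digit_less:
  assumes "b \<ge> 2"
  shows "digit b x n < b"
proof (cases "n < length (int_digits b (nat \<lfloor>\<bar>x\<bar>\<rfloor>))")
  case True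
  then show ?thesis
    using subsetD[OF set_int_digits_subset[OF assms] nth_mem[OF True]] by (simp add: digit_def)
next
  case False
  then show ?thesis
    using assms by (simp add: digit_def frac_digit_def)
qed

lemma foldl_in_states:
  assumes "deterministic_game b V \<delta>" and "v \<in> V" and "set w \<subseteq> {..<b}"
  shows "foldl \<delta> v w \<in> V"
  using assms(2,3)
proof (induction w arbitrary: v)
  case (Cons a w)
  then show ?case
    using assms(1) by (simp add: deterministic_game_def)
qed simp

lemma foldl_sink:
  assumes "sink b V \<delta> t" and "set w \<subseteq> {..<b}"
  shows "foldl \<delta> t w = t"
  using assms(2)
proof (induction w)
  case (Cons a w)
  then show ?case
    using assms(1) by (simp add: sink_def)
qed simp

lemma play_in_states:
  assumes "deterministic_game b V \<delta>" and "v0 \<in> V" and "\<And>n. d n < b"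
  shows "play \<delta> d v0 n \<in> V"
  using assms by (induction n) (auto simp: deterministic_game_def)

lemma play_block:
  assumes "\<And>j. j < length w \<Longrightarrow> d (i + j) = w ! j"
  shows "play \<delta> d v0 (i + length w) = foldl \<delta> (play \<delta> d v0 i) w"
  using assms
proof (induction w rule: rev_induct)
  case (snoc a w)
  have "d (i + j) = w ! j" if "j < length w" for j
    using snoc.prems[of j] that by (simp add: nth_append)
  then have "play \<delta> d v0 (i + length w) = foldl \<delta> (play \<delta> d v0 i) w"
    by (rule snoc.IH)
  moreover have "d (i + length w) = a"
    using snoc.prems[of "length w"] by simp
  ultimately show ?case
    by simp
qed simp

text \<open>
  The path given for a state depends on that state, whereas during a play the current state is
  unknown; this lemma exchanges the two quantifiers. The induction is over the set of states
  already won, with the transition structure on all of \<^term>\<open>V\<close> kept fixed, because the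
  intermediate states need not belong to that set.
\<close>

lemma ex_universally_winning_word:
  assumes game: "deterministic_game b V \<delta>"
    and sink: "sink b V \<delta> t"
    and win: "cannot_be_lost b V \<delta> t"
  shows "\<exists>w. set w \<subseteq> {..<b} \<and> (\<forall>v\<in>V. foldl \<delta> v w = t)"
proof -
  have "finite V"
    using game by (simp add: deterministic_game_def)
  then show ?thesis
  proof (induction rule: finite_subset_induct[OF _ subset_refl, consumes 1, case_names empty insert])
    case empty
    show ?case
      by (rule exI[of _ "[]"]) simp
  next
    case (insert u S)
    obtain w where w: "set w \<subseteq> {..<b}" "\<forall>v\<in>S. foldl \<delta> v w = t"
      using insert.IH by blast
    have "foldl \<delta> u w \<in> V"
      using foldl_in_states[OF game \<open>u \<in> V\<close> w(1)] .
    then obtain w' where w': "set w' \<subseteq> {..<b}" "foldl \<delta> (foldl \<delta> u w) w' = t"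
      using win by (auto simp: cannot_be_lost_def maps_to_def)
    have "\<forall>v\<in>insert u S. foldl \<delta> v (w @ w') = t"
      using w(2) w'(2) foldl_sink[OF sink w'(1)] by simp
    then show ?case
      using w(1) w'(1) by (intro exI[of _ "w @ w'"]) simp
  qed
qed

theorem theorem3p4:
  fixes x :: real and b :: nat and V :: "'v set" and \<delta> :: "'v \<Rightarrow> nat \<Rightarrow> 'v" and t v0 :: 'v
  assumes "disjunctive x"
    and "b \<ge> 2"
    and "deterministic_game b V \<delta>"
    and "sink b V \<delta> t"
    and "\<And>v. sink b V \<delta> v \<Longrightarrow> v = t"
    and "cannot_be_lost b V \<delta> t"
    and "v0 \<in> V"
  shows "wins x b \<delta> t v0"
proof -
  obtain w where w: "set w \<subseteq> {..<b}" "\<And>v. v \<in> V \<Longrightarrow> foldl \<delta> v w = t"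
    using ex_universally_winning_word[OF assms(3,4,6)] by blast
  \<comment> \<open>Disjunctiveness only provides nonempty blocks; the empty word occurs at every position.\<close>
  have "\<exists>i. \<forall>j<length w. digit b x (i + j) = w ! j"
    using assms(1,2) w(1)
    by (cases "w = []") (auto simp: disjunctive_def disjunctive_in_base_def)
  then obtain i where i: "\<And>j. j < length w \<Longrightarrow> digit b x (i + j) = w ! j"
    by blast
  have "play \<delta> (digit b x) v0 (i + length w) = foldl \<delta> (play \<delta> (digit b x) v0 i) w"
    using i by (rule play_block)
  also have "\<dots> = t"
    using w(2) play_in_states[OF assms(3,7) digit_less[OF assms(2)]] .
  finally show ?thesis
    unfolding wins_def by blast
qed

end
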